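(* Let $q$ be a prime power and $L(x)=ax+bx^q+cx^{q^2}\in\mathbb{F}_{q^5}[x]$. Let $u=\frac{a^qc}{b^{q+1}}$. Then $L(x)$ has $q^2$ roots in $\mathbb{F}_{q^5}$ if and only if $b\neq 0$, $(1-u)^{q^2+1}-u^q=0$, and $N(1-u)=N(c/b)$, where $N$ is the norm from $\mathbb{F}_{q^5}$ to $\mathbb{F}_q$.
   Context: $N(x)=x^{1+q+q^2+q^3+q^4}$ for $x\in\mathbb{F}_{q^5}$. Roots are counted in $\mathbb{F}_{q^5}$. *)

theory Defs
  imports
    "HOL-Computational_Algebra.Computational_Algebra"
    "HOL-Library.Cardinality"
    "HOL-Number_Theory.Prime_Powers"
begin

(* If CARD('a) = q^5, then 'a is the field with q^5 elements, and its subfield with q elements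
   is {x. x^q = x}. *)

definition lin_trinomial :: "nat \<Rightarrow> 'a \<Rightarrow> 'a \<Rightarrow> 'a \<Rightarrow> 'a::comm_ring_1 poly" where
  "lin_trinomial q a b c = monom a 1 + monom b q + monom c (q ^ 2)"

definition norm5 :: "nat \<Rightarrow> 'a \<Rightarrow> 'a::comm_monoid_mult" where
  "norm5 q x = x ^ (1 + q + q ^ 2 + q ^ 3 + q ^ 4)"

end

theory Submission
  imports Defs
begin

text \<open>
  If \<open>c \<noteq> 0\<close>, the roots of \<open>L\<close> are the solutions of \<open>x^(q^2) = A x + B x^q\<close> with \<open>A = -a/c\<close> and
  \<open>B = -b/c\<close>. Iterating this relation gives \<open>x^(q^5) = P x + Q x^q\<close> for every root. As
  \<open>x^(q^5) = x\<close>, having \<open>q^2\<close> roots forces \<open>P = 1\<close> and \<open>Q = 0\<close>, since otherwise the roots would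
  satisfy a nontrivial equation of degree at most \<open>q\<close>. Conversely, if \<open>P = 1\<close> and \<open>Q = 0\<close>, then
  \<open>x^(q^5) - x = M (L x)\<close> for some additive polynomial \<open>M\<close> of degree \<open>q^3\<close>. So the image of \<open>L\<close>
  has at most \<open>q^3\<close> elements, and its kernel has at least \<open>q^5 / q^3\<close>.
\<close>

section \<open>Finite fields, additive maps and root bounds\<close>

text \<open>Multiplication by a nonzero \<open>x\<close> permutes the units, so their product
  absorbs the factor \<open>x ^ card ?U\<close>.\<close>

lemma finite_field_power_CARD:
  fixes x :: "'a::{field,finite}"
  shows "x ^ CARD('a) = x"
proof (cases "x = 0")
  case False
  let ?U = "UNIV - {0::'a}"
  have "bij_betw ((*) x) ?U ?U"
    using False by (intro bij_betwI[where g = "\<lambda>y. y / x"]) auto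
  then have "\<Prod>?U = (\<Prod>y\<in>?U. x * y)"
    by (simp add: prod.reindex_bij_betw[where g = "\<lambda>y. y"])
  also have "\<dots> = x ^ card ?U * \<Prod>?U"
    by (simp add: prod.distrib)
  finally have "x ^ card ?U = 1"
    by simp
  moreover have "CARD('a) = Suc (card ?U)"
    using card.remove[of "UNIV :: 'a set" 0] by simp
  ultimately show ?thesis
    by (metis mult_1_right power_Suc)
qed simp

text \<open>Translation by 1 permutes the field, so summing over it shows that
  \<open>CARD('a)\<close> vanishes there. Hence the characteristic is the prime below
  \<open>q\<close>.\<close>

lemma primepow_power_CHAR:
  assumes "primepow q" "CARD('a::{field,finite}) = q ^ n"
  shows "prime CHAR('a) \<and> (\<exists>k. q = CHAR('a) ^ k)"
proof -
  have prime: "prime CHAR('a)"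
    by (simp add: finite_imp_CHAR_pos prime_CHAR_semidom)
  obtain p k where pk: "prime p" "q = p ^ k"
    using assms(1) by (auto simp: primepow_def)
  have "(\<Sum>x\<in>UNIV. x + 1) = (\<Sum>x\<in>UNIV. x :: 'a)"
    by (rule sum.reindex_bij_witness[of _ "\<lambda>x. x - 1" "\<lambda>x. x + 1"]) auto
  then have "of_nat CARD('a) = (0 :: 'a)"
    by (simp add: sum.distrib)
  then have "CHAR('a) dvd p ^ (k * n)"
    by (simp add: of_nat_eq_0_iff_char_dvd assms(2) pk(2) power_mult del: of_nat_power)
  then have "CHAR('a) = p"
    using prime pk(1) prime_dvd_power primes_dvd_imp_eq by blast
  then show ?thesis
    using prime pk(2) by blast
qed

text \<open>Every nonempty fiber is a translate of the kernel.\<close>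

lemma additive_card_le:
  fixes f :: "'a::{ab_group_add,finite} \<Rightarrow> 'b::ab_group_add"
  assumes "\<And>x y. f (x - y) = f x - f y"
  shows "CARD('a) \<le> card (range f) * card {x. f x = 0}"
proof -
  have fiber: "card {x. f x = f z} \<le> card {x. f x = 0}" for z
    by (rule card_inj_on_le[where f = "\<lambda>x. x - z"]) (auto simp: assms inj_on_def)
  have "(UNIV :: 'a set) = (\<Union>y\<in>range f. {x. f x = y})"
    by auto
  then have "CARD('a) \<le> (\<Sum>y\<in>range f. card {x. f x = y})"
    using card_UN_le[of "range f" "\<lambda>y. {x. f x = y}"] by simp
  also have "\<dots> \<le> card (range f) * card {x. f x = 0}"
    using sum_bounded_above[of "range f" "\<lambda>y. card {x. f x = y}" "card {x. f x = 0}"] fiber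
    by auto
  finally show ?thesis .
qed

lemma card_roots_linear_binomial_le:
  fixes a b :: "'a::idom"
  assumes "q > 1" "a \<noteq> 0 \<or> b \<noteq> 0"
  shows "card {x. a * x + b * x ^ q = 0} \<le> q"
proof -
  let ?p = "monom a 1 + monom b q"
  have "coeff ?p 1 = a" "coeff ?p q = b"
    using assms(1) by simp_all
  then have "?p \<noteq> 0"
    using assms(2) by (metis coeff_0)
  moreover have "degree ?p \<le> q"
    using assms(1) by (intro degree_add_le) (auto intro: order_trans[OF degree_monom_le])
  ultimately show ?thesis
    using card_poly_roots_bound[of ?p] by (simp add: poly_monom)
qed

section \<open>Frobenius powers on the field with \<open>q ^ 5\<close> elements\<close>

locale quintic_extension =
  fixes q :: nat and field_type :: "'a::{field,finite} itself"
  assumes primepow: "primepow q"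
    and card_field: "CARD('a) = q ^ 5"
begin

lemma q_gt_1: "q > 1"
  using primepow primepow_gt_Suc_0 by simp

lemma frob_add: "(x + y :: 'a) ^ q ^ i = x ^ q ^ i + y ^ q ^ i"
proof -
  obtain k where "prime CHAR('a)" "q = CHAR('a) ^ k"
    using primepow_power_CHAR[OF primepow card_field] by auto
  then show ?thesis
    by (intro freshmans_dream'[where n = "k * i"]) (auto simp: power_mult)
qed

lemma frob_minus: "(- x :: 'a) ^ q ^ i = - (x ^ q ^ i)"
  using frob_add[of x "- x" i] q_gt_1 by (simp add: eq_neg_iff_add_eq_0 add.commute power_0_left)

lemma frob_diff: "(x - y :: 'a) ^ q ^ i = x ^ q ^ i - y ^ q ^ i"
  using frob_add[of x "- y" i] by (simp add: frob_minus)

lemma frob_frob: "((x :: 'a) ^ q ^ i) ^ q ^ j = x ^ q ^ (i + j)"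
  by (simp add: power_add flip: power_mult)

text \<open>Companion of \<open>frob_frob\<close> for the bare exponent \<open>q\<close>, the form
  to which \<open>q ^ 1\<close> simplifies.\<close>

lemma frob_Suc: "((x :: 'a) ^ q) ^ q ^ i = x ^ q ^ (i + 1)"
  by (simp flip: power_mult)

lemma frob_5: "(x :: 'a) ^ q ^ 5 = x"
  using finite_field_power_CARD[of x] by (simp add: card_field)

text \<open>
  The polynomial \<open>x^(q^5)\<close> leaves the remainder \<open>rem0 A B * x + rem1 A B * x^q\<close> modulo
  \<open>x^(q^2) - A x - B x^q\<close>.
\<close>

definition rem0 :: "'a \<Rightarrow> 'a \<Rightarrow> 'a" where
  "rem0 A B = A * (A ^ q ^ 3 * B ^ q + B ^ q ^ 3 * (A ^ q ^ 2 + B ^ q * B ^ q ^ 2))"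

definition rem1 :: "'a \<Rightarrow> 'a \<Rightarrow> 'a" where
  "rem1 A B = A ^ q ^ 3 * (A ^ q + B * B ^ q)
    + B ^ q ^ 3 * (A ^ q ^ 2 * B + B ^ q ^ 2 * (A ^ q + B * B ^ q))"

lemma power_q_square_iterate:
  fixes A B x :: 'a
  assumes "x ^ q ^ 2 = A * x + B * x ^ q"
  defines "P \<equiv> rem0 A B" and "Q \<equiv> rem1 A B"
  shows "x = P * x + Q * x ^ q"
proof -
  have step: "x ^ q ^ (2 + i) = A ^ q ^ i * x ^ q ^ i + B ^ q ^ i * x ^ q ^ (i + 1)" for i
    using arg_cong[OF assms(1), of "\<lambda>y. y ^ q ^ i"] frob_Suc[of x i]
    by (simp add: frob_add frob_frob power_mult_distrib)
  have "x = A ^ q ^ 3 * x ^ q ^ 3 + B ^ q ^ 3 * x ^ q ^ 4"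
    using step[of 3] by (simp add: frob_5)
  also have "x ^ q ^ 4 = A ^ q ^ 2 * x ^ q ^ 2 + B ^ q ^ 2 * x ^ q ^ 3"
    using step[of 2] by simp
  also have "x ^ q ^ 3 = A ^ q * x ^ q + B ^ q * x ^ q ^ 2"
    using step[of 1] by (simp add: power2_eq_square)
  also note assms(1)
  finally show ?thesis
    by (simp add: P_def Q_def rem0_def rem1_def algebra_simps)
qed

lemma card_roots_iff:
  fixes A B :: 'a
  defines "P \<equiv> rem0 A B" and "Q \<equiv> rem1 A B"
    and "K \<equiv> {x. x ^ q ^ 2 - A * x - B * x ^ q = 0}"
  shows "card K = q ^ 2 \<longleftrightarrow> P = 1 \<and> Q = 0"
proof
  assume card: "card K = q ^ 2"
  have "K \<subseteq> {x. (P - 1) * x + Q * x ^ q = 0}"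
  proof
    fix x assume "x \<in> K"
    then have "x ^ q ^ 2 = A * x + B * x ^ q"
      by (simp add: K_def diff_eq_eq)
    then have "x = P * x + Q * x ^ q"
      unfolding P_def Q_def by (rule power_q_square_iterate)
    then show "x \<in> {x. (P - 1) * x + Q * x ^ q = 0}"
      by (simp add: algebra_simps)
  qed
  then have "q ^ 2 \<le> card {x. (P - 1) * x + Q * x ^ q = 0}"
    using card card_mono[of "{x. (P - 1) * x + Q * x ^ q = 0}" K] by simp
  moreover have "\<not> q ^ 2 \<le> q"
    using q_gt_1 by (simp add: power2_eq_square)
  ultimately show "P = 1 \<and> Q = 0"
    using card_roots_linear_binomial_le[OF q_gt_1, of "P - 1" Q] by fastforce
next
  assume PQ: "P = 1 \<and> Q = 0"
  define f where "f x = x ^ q ^ 2 - A * x - B * x ^ q" for x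
  \<comment> \<open>\<open>p\<close> is the quotient of \<open>x^(q^5) - x\<close> by \<open>f\<close> with respect to composition.\<close>
  define c1 where "c1 = A ^ q ^ 3 + B ^ q ^ 3 * B ^ q ^ 2"
  define c0 where "c0 = c1 * B ^ q + B ^ q ^ 3 * A ^ q ^ 2"
  define p where "p = monom 1 (q ^ 3) + (monom (B ^ q ^ 3) (q ^ 2) + monom c1 q + monom c0 1)"
  define l where "l = monom 1 (q ^ 2) + (monom (- B) q + monom (- A) 1)"
  have less: "1 < q" "q < q ^ 2" "q ^ 2 < q ^ 3" "q < q ^ 3" "1 < q ^ 3"
    using q_gt_1 power_strict_increasing[of 1 2 q] power_strict_increasing[of 2 3 q]
      power_strict_increasing[of 1 3 q] one_less_power[of q 3] by simp_all
  have "degree (monom (B ^ q ^ 3) (q ^ 2) + monom c1 q + monom c0 1) < q ^ 3"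
    using less by (intro degree_add_less) (auto intro: le_less_trans[OF degree_monom_le])
  then have degree_p: "degree p = q ^ 3"
    unfolding p_def by (simp add: degree_add_eq_left degree_monom_eq)
  have "degree (monom (- B) q + monom (- A) 1) < q ^ 2"
    using less by (intro degree_add_less) (auto intro: le_less_trans[OF degree_monom_le])
  then have degree_l: "degree l = q ^ 2"
    unfolding l_def by (simp add: degree_add_eq_left degree_monom_eq)
  have "poly p (f x) = 0" for x
  proof -
    have frob_f: "f x ^ q ^ i = x ^ q ^ (2 + i) - A ^ q ^ i * x ^ q ^ i - B ^ q ^ i * x ^ q ^ (i + 1)" for i
      using frob_Suc[of x i]
      by (simp add: f_def frob_diff frob_frob power_mult_distrib)
    have f3: "f x ^ q ^ 3 = x - A ^ q ^ 3 * x ^ q ^ 3 - B ^ q ^ 3 * x ^ q ^ 4"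
      using frob_f[of 3] by (simp add: frob_5)
    have f2: "f x ^ q ^ 2 = x ^ q ^ 4 - A ^ q ^ 2 * x ^ q ^ 2 - B ^ q ^ 2 * x ^ q ^ 3"
      using frob_f[of 2] by simp
    have f1: "f x ^ q = x ^ q ^ 3 - A ^ q * x ^ q - B ^ q * x ^ q ^ 2"
      using frob_f[of 1] by (simp add: power2_eq_square)
    have "poly p (f x) = f x ^ q ^ 3 + (B ^ q ^ 3 * f x ^ q ^ 2 + c1 * f x ^ q + c0 * f x)"
      by (simp add: p_def poly_monom)
    \<comment> \<open>The coefficient \<open>B ^ q ^ 3\<close> cancels \<open>x ^ q ^ 4\<close>,
      \<open>c1\<close> cancels \<open>x ^ q ^ 3\<close> and \<open>c0\<close> cancels
      \<open>x ^ q ^ 2\<close>.\<close>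
    also have "\<dots> = x - P * x - Q * x ^ q"
      unfolding f3 f2 f1 unfolding P_def Q_def rem0_def rem1_def c0_def c1_def f_def by (simp add: algebra_simps)
    finally have "poly p (f x) = x - P * x - Q * x ^ q" .
    then show ?thesis
      using PQ by simp
  qed
  then have "range f \<subseteq> {y. poly p y = 0}"
    by auto
  then have "card (range f) \<le> card {y. poly p y = 0}"
    by (intro card_mono) auto
  also have "\<dots> \<le> q ^ 3"
    using card_poly_roots_bound[of p] degree_p q_gt_1 by fastforce
  finally have "card (range f) * card {x. f x = 0} \<le> q ^ 3 * card K"
    by (simp add: f_def K_def)
  moreover have "CARD('a) \<le> card (range f) * card {x. f x = 0}"
    using frob_diff[where i = 1]
    by (intro additive_card_le) (simp add: f_def frob_diff right_diff_distrib)
  ultimately have "q ^ 3 * q ^ 2 \<le> q ^ 3 * card K"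
    by (simp add: card_field flip: power_add)
  then have "q ^ 2 \<le> card K"
    using q_gt_1 by (simp only: mult_le_cancel1) simp
  moreover have "K = {x. poly l x = 0}"
    by (simp add: K_def l_def poly_monom algebra_simps)
  then have "card K \<le> q ^ 2"
    using card_poly_roots_bound[of l] degree_l q_gt_1 by fastforce
  ultimately show "card K = q ^ 2"
    by simp
qed

section \<open>Translation into norm conditions\<close>

text \<open>Substituting \<open>A ^ q = - (u * B * B ^ q)\<close> turns \<open>Q\<close> into a
  nonzero multiple of the first condition. Modulo that condition, \<open>P\<close> is minus the norm
  of \<open>B\<close> times the norm of \<open>1 - u\<close>.\<close>

lemma norm_conditions:
  fixes A B :: 'a
  assumes "B \<noteq> 0"
  defines "P \<equiv> rem0 A B" and "Q \<equiv> rem1 A B"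
    and "u \<equiv> - (A ^ q / (B * B ^ q))"
  shows "P = 1 \<and> Q = 0 \<longleftrightarrow>
    (1 - u) ^ (q ^ 2 + 1) - u ^ q = 0 \<and> norm5 q (1 - u) = norm5 q (- (1 / B))"
proof -
  have norm5_eq: "norm5 q x = x * x ^ q * x ^ q ^ 2 * x ^ q ^ 3 * x ^ q ^ 4" for x :: 'a
    by (simp add: norm5_def power_add)
  define w where "w = 1 - u"
  have w: "w ^ q ^ i = 1 - u ^ q ^ i" for i
    by (simp add: w_def frob_diff)
  define N where "N = B * B ^ q * B ^ q ^ 2 * B ^ q ^ 3 * B ^ q ^ 4"
  have N: "N \<noteq> 0"
    using assms(1) by (simp add: N_def)
  have A_Suc: "A ^ q ^ (i + 1) = - (u ^ q ^ i * B ^ q ^ i * B ^ q ^ (i + 1))" for i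
  proof -
    have "A ^ q = - (u * B * B ^ q)"
      using assms(1) by (simp add: u_def)
    from arg_cong[OF this, of "\<lambda>y. y ^ q ^ i"] show ?thesis
      using frob_Suc[of A i] frob_Suc[of B i]
      by (simp add: frob_minus power_mult_distrib)
  qed
  have A2: "A ^ q ^ 2 = - (u ^ q * B ^ q * B ^ q ^ 2)"
    using A_Suc[of 1] by (simp add: power2_eq_square)
  \<comment> \<open>As \<open>u\<close> gives only \<open>A ^ q\<close>, \<open>A\<close> itself is
    reached as \<open>A ^ q ^ 5\<close>, with \<open>i = 4\<close>.\<close>
  have A: "A ^ q = - (u * B * B ^ q)" "A ^ q ^ 3 = - (u ^ q ^ 2 * B ^ q ^ 2 * B ^ q ^ 3)"
    "A = - (u ^ q ^ 4 * B ^ q ^ 4 * B)"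
    using A_Suc[of 0] A_Suc[of 2] A_Suc[of 4] by (simp_all add: frob_5)
  have Q: "Q = B * B ^ q * B ^ q ^ 2 * B ^ q ^ 3 * ((1 - u ^ q ^ 2) * (1 - u) - u ^ q)"
    by (simp add: Q_def rem1_def A2 A(1,2) algebra_simps)
  have P: "P = - (N * (u ^ q ^ 4 * (1 - u ^ q - u ^ q ^ 2)))"
    unfolding P_def rem0_def N_def A2 A(2) by (subst A(3)) (simp add: algebra_simps)
  have cond: "(1 - u) ^ (q ^ 2 + 1) - u ^ q = w ^ q ^ 2 * w - u ^ q"
    by (simp add: w_def mult.commute)
  have norm: "norm5 q (1 - u) = norm5 q (- (1 / B)) \<longleftrightarrow> - (N * norm5 q w) = 1"
  proof -
    \<comment> \<open>Each of the five conjugates contributes a sign, whatever the parity of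
      \<open>q\<close>, and five is odd.\<close>
    have "norm5 q (- (1 / B)) = - (1 / N)"
      using frob_minus[where i = 1] by (simp add: norm5_eq N_def frob_minus power_divide)
    moreover have "- (N * x) = 1 \<longleftrightarrow> x = - (1 / N)" for x
    proof
      assume "- (N * x) = 1"
      then have "N * - x = 1"
        by simp
      then have "- x = 1 / N"
        using N by (simp add: eq_divide_eq mult.commute)
      then show "x = - (1 / N)"
        by (metis minus_minus)
    qed (use N in simp)
    ultimately show ?thesis
      by (simp add: w_def)
  qed
  \<comment> \<open>Modulo \<open>Q = 0\<close>, every conjugate of \<open>u\<close> is both \<open>1\<close> minus a conjugate of \<open>w\<close> and a product
    of two conjugates of \<open>w\<close>.\<close>
  have "u ^ q ^ 4 * (1 - u ^ q - u ^ q ^ 2) = norm5 q w" if "w ^ q ^ 2 * w = u ^ q"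
  proof -
    have *: "w ^ q ^ (2 + i) * w ^ q ^ i = u ^ q ^ (i + 1)" for i
      using arg_cong[OF that, of "\<lambda>y. y ^ q ^ i"] frob_Suc[of u i]
      by (simp add: frob_frob power_mult_distrib)
    have "u ^ q ^ 4 = w * w ^ q ^ 3"
      using *[of 3] by (simp add: frob_5)
    moreover have "u ^ q ^ 2 = w ^ q ^ 3 * w ^ q"
      using *[of 1] by (simp add: power2_eq_square)
    moreover have "u ^ q ^ 3 = w ^ q ^ 4 * w ^ q ^ 2"
      using *[of 2] by simp
    moreover have "1 - u ^ q = w ^ q" "1 - w ^ q ^ 3 = u ^ q ^ 3"
      using w[of 1] w[of 3] by simp_all
    ultimately have "u ^ q ^ 4 * (1 - u ^ q - u ^ q ^ 2) = w * w ^ q ^ 3 * (w ^ q - w ^ q ^ 3 * w ^ q)"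
      and w3: "1 - w ^ q ^ 3 = w ^ q ^ 4 * w ^ q ^ 2"
      by simp_all
    \<comment> \<open>The bracket supplies the three missing conjugates: \<open>w ^ q\<close>
      factors out, and \<open>1 - w ^ q ^ 3\<close> is the product of the other two.\<close>
    moreover have "w ^ q - w ^ q ^ 3 * w ^ q = w ^ q * (1 - w ^ q ^ 3)"
      by (simp add: right_diff_distrib mult.commute)
    ultimately show ?thesis
      unfolding norm5_eq w3 by (simp only: ac_simps)
  qed
  moreover have "Q = 0 \<longleftrightarrow> w ^ q ^ 2 * w = u ^ q"
    unfolding Q w using assms(1) by (simp add: w_def)
  ultimately show ?thesis
    unfolding cond norm P by auto
qed

end

section \<open>Reduction to the monic relation\<close>

theorem theorem2:
  fixes q :: nat and a b c u :: "'a::{field,finite}"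
  assumes "primepow q"
    and "CARD('a) = q ^ 5"
    and "u = a ^ q * c / b ^ (q + 1)"
  shows "card {x. poly (lin_trinomial q a b c) x = 0} = q ^ 2 \<longleftrightarrow>
    b \<noteq> 0 \<and> (1 - u) ^ (q ^ 2 + 1) - u ^ q = 0 \<and> norm5 q (1 - u) = norm5 q (c / b)"
proof -
  interpret quintic_extension q "TYPE('a)"
    using assms(1,2) by unfold_locales
  have poly: "poly (lin_trinomial q a b c) x = a * x + b * x ^ q + c * x ^ q ^ 2" for x
    by (simp add: lin_trinomial_def poly_monom)
  show ?thesis
  proof (cases "c = 0")
    case True
    \<comment> \<open>For \<open>c = 0\<close> both sides fail: there are at most \<open>q\<close>
      roots or all \<open>q ^ 5\<close>, and \<open>u = 0\<close> turns the first condition into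
      \<open>1 = 0\<close>.\<close>
    have "card {x. a * x + b * x ^ q = 0} \<noteq> q ^ 2"
    proof (cases "a \<noteq> 0 \<or> b \<noteq> 0")
      case True
      moreover have "q < q ^ 2"
        using q_gt_1 by (simp add: power2_eq_square)
      ultimately show ?thesis
        using card_roots_linear_binomial_le[OF q_gt_1, of a b] by linarith
    next
      case False
      then show ?thesis
        using q_gt_1 by (simp add: assms(2))
    qed
    then show ?thesis
      unfolding poly using True assms(3) q_gt_1 by (simp add: power_0_left)
  next
    case c: False
    define A where "A = - (a / c)"
    define B where "B = - (b / c)"
    have "{x. poly (lin_trinomial q a b c) x = 0} = {x. x ^ q ^ 2 - A * x - B * x ^ q = 0}"
      using c by (auto simp: poly A_def B_def field_simps)
    note iff = card_roots_iff[of A B, folded this]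
    show ?thesis
    proof (cases "b = 0")
      case True
      \<comment> \<open>Here \<open>B = 0\<close>, so \<open>rem0 A B\<close> is 0 instead of
        1.\<close>
      then show ?thesis
        unfolding iff using q_gt_1 by (auto simp: B_def rem0_def rem1_def power_0_left)
    next
      case False
      have "c / b = - (1 / B)"
        by (simp add: B_def)
      moreover have "u = - (A ^ q / (B * B ^ q))"
        using c False frob_minus[of "a / c" 1] frob_minus[of "b / c" 1]
        by (simp add: assms(3) A_def B_def power_divide)
      moreover have "B \<noteq> 0"
        using c False by (simp add: B_def)
      ultimately show ?thesis
        unfolding iff using norm_conditions[of B A] False by simp
    qed
  qed
qed

end
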